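(* Let $F$ be a forest. Then $$\mathfrak{M}(F,\mathbf{x}_F)=\det\big(\mathbf{X}_F-A(F)\big),$$ where $\mathbf{X}_F$ is the diagonal matrix whose rows and columns are indexed by $V(F)$ and whose $(v,v)$-entry is $x_v$ for every vertex $v\in V(F)$. In particular, $\mathcal{M}(F,x)=\varphi(A(F),x)$ and $\mathcal{LM}(F,x)=\varphi(L(F),x)$.
   Context: All graphs are finite, undirected, without loops or multiple edges. $V(G)$ and $E(G)$ are the vertex and edge sets and $d_G(v)$ is the degree of $v$ in $G$. A matching of $G$ is a set $M\subseteq E(G)$ (possibly empty) no two distinct edges of which share an endpoint; $V(M)$ is the set of endpoints of edges in $M$. In the sums below $M$ ranges over all matchings of $G$. For a vector $\mathbf{x}_G=(x_v)_{v\in V(G)}$ of indeterminates, the multivariate matching polynomial is $$\mathfrak{M}(G,\mathbf{x}_G)=\sum_{M}(-1)^{|M|}\prod_{v\in V(G)\setminus V(M)}x_v;$$ the matching polynomial is $\mathcal{M}(G,x)=\sum_{M}(-1)^{|M|}x^{|V(G)\setminus V(M)|}$; the Laplacian matching polynomial is $$\mathcal{LM}(G,x)=\sum_{M}(-1)^{|M|}\prod_{v\in V(G)\setminus V(M)}\big(x-d_G(v)\big).$$ $A(G)$ is the adjacency matrix, $D(G)$ the diagonal matrix of vertex degrees, and $L(G)=D(G)-A(G)$ the Laplacian matrix. $\varphi(N,x)=\det(xI-N)$ is the characteristic polynomial of a square matrix $N$. *)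

theory Defs
  imports
    "HOL-Library.Poly_Mapping"
    "Jordan_Normal_Form.Char_Poly"
begin

definition simple_graph :: "'v set \<Rightarrow> 'v set set \<Rightarrow> bool" where
  "simple_graph V E \<longleftrightarrow> finite V \<and> (\<forall>e\<in>E. e \<subseteq> V \<and> card e = 2)"

definition vertex_degree :: "'v set set \<Rightarrow> 'v \<Rightarrow> nat" where
  "vertex_degree E v = card {e \<in> E. v \<in> e}"

(* A cycle is given by the cyclic sequence of its (at least three) pairwise distinct vertices. *)
definition is_cycle :: "'v set set \<Rightarrow> 'v list \<Rightarrow> bool" where
  "is_cycle E c \<longleftrightarrow> 3 \<le> length c \<and> distinct c \<and>
     (\<forall>i<length c. {c ! i, c ! (Suc i mod length c)} \<in> E)"

definition forest :: "'v set \<Rightarrow> 'v set set \<Rightarrow> bool" where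
  "forest V E \<longleftrightarrow> simple_graph V E \<and> (\<nexists>c. is_cycle E c)"

definition matchings :: "'v set set \<Rightarrow> 'v set set set" where
  "matchings E = {M. M \<subseteq> E \<and> (\<forall>e\<in>M. \<forall>f\<in>M. e \<noteq> f \<longrightarrow> e \<inter> f = {})}"

(* In the three polynomials below, the set of endpoints of a matching M is \<Union>M. *)

definition multivariate_matching_poly ::
    "'v set \<Rightarrow> 'v set set \<Rightarrow> ('v \<Rightarrow> 'a::comm_ring_1) \<Rightarrow> 'a" where
  "multivariate_matching_poly V E x =
     (\<Sum>M\<in>matchings E. (-1) ^ card M * (\<Prod>v\<in>V - \<Union>M. x v))"

definition matching_poly :: "'v set \<Rightarrow> 'v set set \<Rightarrow> 'r::comm_ring_1 poly" where
  "matching_poly V E = (\<Sum>M\<in>matchings E. (-1) ^ card M * [:0, 1:] ^ card (V - \<Union>M))"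

definition laplacian_matching_poly :: "'v set \<Rightarrow> 'v set set \<Rightarrow> 'r::comm_ring_1 poly" where
  "laplacian_matching_poly V E =
     (\<Sum>M\<in>matchings E. (-1) ^ card M *
        (\<Prod>v\<in>V - \<Union>M. [:0, 1:] - of_nat (vertex_degree E v)))"

(* The indeterminate x_v of the polynomial ring over 'r with variables indexed by 'v:
   a polynomial maps monomials, i.e. finitely supported exponent vectors, to coefficients. *)
definition indet :: "'v \<Rightarrow> ('v \<Rightarrow>\<^sub>0 nat) \<Rightarrow>\<^sub>0 'r::comm_ring_1" where
  "indet v = Poly_Mapping.single (Poly_Mapping.single v 1) 1"

(* Library matrices are indexed by {0..<n}; vertex-indexed matrices are represented along a list
   vs enumerating the vertices, row and column i belonging to vs ! i. *)

definition vertex_diag_mat :: "'v list \<Rightarrow> ('v \<Rightarrow> 'a::zero) \<Rightarrow> 'a mat" where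
  "vertex_diag_mat vs x = mat_diag (length vs) (\<lambda>i. x (vs ! i))"

definition adjacency_mat :: "'v set set \<Rightarrow> 'v list \<Rightarrow> 'a::zero_neq_one mat" where
  "adjacency_mat E vs =
     Matrix.mat (length vs) (length vs) (\<lambda>(i, j). if {vs ! i, vs ! j} \<in> E then 1 else 0)"

definition degree_mat :: "'v set set \<Rightarrow> 'v list \<Rightarrow> 'a::comm_ring_1 mat" where
  "degree_mat E vs = vertex_diag_mat vs (\<lambda>v. of_nat (vertex_degree E v))"

definition laplacian_mat :: "'v set set \<Rightarrow> 'v list \<Rightarrow> 'a::comm_ring_1 mat" where
  "laplacian_mat E vs = degree_mat E vs - adjacency_mat E vs"

end

theory Submission
  imports Defs "HOL-Combinatorics.Cycles"
begin

text \<open>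
  In the Leibniz expansion of the determinant over the vertices of a graph, a permutation
  contributes only if it moves each vertex to itself or to a neighbour. An orbit of length at
  least three of such a permutation is a cycle of the graph, so for a forest only involutions
  survive. An involution is the same thing as the matching formed by its two-element orbits, its
  sign is minus one to the number of these edges, and its fixed points are the unmatched vertices.
  Every edge of the matching contributes two off-diagonal entries, so their common value enters
  only through its square; this is why the signs of the adjacency entries do not matter and the
  Laplacian is covered as well.
\<close>

section \<open>Leibniz expansion indexed by vertices\<close>

text \<open>Conjugation by the enumeration \<open>(!) vs\<close> turns permutations of the indices
  into permutations of the vertices and keeps the sign. This lets the combinatorics below take place
  on the vertex set itself.\<close>

lemma det_mat_nth:
  fixes B :: "'v \<Rightarrow> 'v \<Rightarrow> 'a::comm_ring_1"
  assumes "distinct vs"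
  shows "det (Matrix.mat (length vs) (length vs) (\<lambda>(i, j). B (vs ! i) (vs ! j))) =
    (\<Sum>p | p permutes set vs. of_int (sign p) * (\<Prod>v\<in>set vs. B v (p v)))"
proof -
  let ?n = "length vs" and ?f = "(!) vs"
  let ?g = "inv_into {0..<?n} ?f"
  have f: "bij_betw ?f {0..<?n} (set vs)"
    using bij_betw_nth[OF assms, of "{0..<?n}"] by (simp add: atLeast0LessThan)
  then have inj: "inj_on ?f {0..<?n}" by (rule bij_betw_imp_inj_on)
  have g: "bij_betw ?g (set vs) {0..<?n}" by (rule bij_betw_inv_into[OF f])
  have "det (Matrix.mat ?n ?n (\<lambda>(i, j). B (vs ! i) (vs ! j))) =
    (\<Sum>p | p permutes {0..<?n}. of_int (sign p) *
      (\<Prod>i = 0..<?n. Matrix.mat ?n ?n (\<lambda>(i, j). B (vs ! i) (vs ! j)) $$ (i, p i)))"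
    by (rule det_def') simp
  also have "\<dots> = (\<Sum>p | p permutes {0..<?n}. of_int (sign p) *
      (\<Prod>i = 0..<?n. B (vs ! i) (vs ! p i)))"
    by (intro sum.cong refl arg_cong2[where f = "(*)"] prod.cong)
      (auto dest: permutes_in_image)
  also have "\<dots> = (\<Sum>p | p permutes set vs. of_int (sign p) * (\<Prod>v\<in>set vs. B v (p v)))"
  proof (rule sum.reindex_bij_witness[where i = "map_permutation (set vs) ?g"
        and j = "map_permutation {0..<?n} ?f"])
    fix p assume "p \<in> {p. p permutes {0..<?n}}"
    then have p: "p permutes {0..<?n}" by simp
    show "map_permutation (set vs) ?g (map_permutation {0..<?n} ?f p) = p"
      by (rule map_permutation_compose_inv[OF f p]) (simp add: inv_into_f_f[OF inj])
    show "map_permutation {0..<?n} ?f p \<in> {p. p permutes set vs}"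
      using map_permutation_permutes[OF f p] by simp
    have "(\<Prod>v\<in>set vs. B v (map_permutation {0..<?n} ?f p v)) =
        (\<Prod>i = 0..<?n. B (?f i) (map_permutation {0..<?n} ?f p (?f i)))"
      by (rule prod.reindex_bij_betw[OF f, symmetric])
    also have "\<dots> = (\<Prod>i = 0..<?n. B (vs ! i) (vs ! p i))"
      by (intro prod.cong refl) (simp add: map_permutation_apply[OF inj])
    finally show "of_int (sign (map_permutation {0..<?n} ?f p)) *
        (\<Prod>v\<in>set vs. B v (map_permutation {0..<?n} ?f p v)) =
        of_int (sign p) * (\<Prod>i = 0..<?n. B (vs ! i) (vs ! p i))"
      using sign_map_permutation[OF inj p] by simp
  next
    fix q assume "q \<in> {p. p permutes set vs}"
    then have q: "q permutes set vs" by simp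
    show "map_permutation {0..<?n} ?f (map_permutation (set vs) ?g q) = q"
      by (rule map_permutation_compose_inv[OF g q]) (rule bij_betw_inv_into_right[OF f])
    show "map_permutation (set vs) ?g q \<in> {p. p permutes {0..<?n}}"
      using map_permutation_permutes[OF g q] by simp
  qed
  finally show ?thesis .
qed

section \<open>Signs of involutions\<close>

text \<open>For an involution these are its two-element orbits; being unordered, each orbit occurs
  once although both of its points produce it.\<close>

definition moved_pairs :: "('v \<Rightarrow> 'v) \<Rightarrow> 'v set set" where
  "moved_pairs p = (\<lambda>v. {v, p v}) ` {v. p v \<noteq> v}"

lemma involution_permutes:
  assumes "\<And>v. p (p v) = v" and "\<And>v. v \<notin> S \<Longrightarrow> p v = v"
  shows "p permutes S"
  unfolding permutes_def using assms by metis

text \<open>Induction on the number of moved points: composing with the transposition of one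
  two-element orbit flips the sign and removes exactly that orbit from the moved pairs.\<close>

lemma sign_involution:
  assumes "finite {v. p v \<noteq> v}" and "\<And>v. p (p v) = v"
  shows "sign p = (-1) ^ card (moved_pairs p)"
  using assms
proof (induction "card {v. p v \<noteq> v}" arbitrary: p rule: less_induct)
  case less
  note fin = less.prems(1) and inv = less.prems(2)
  show ?case
  proof (cases "{v. p v \<noteq> v} = {}")
    case True
    then have "p = id" by auto
    then show ?thesis by (simp add: moved_pairs_def)
  next
    case False
    then obtain a where a: "p a \<noteq> a" by blast
    define q where "q = transpose a (p a) \<circ> p"
    have q: "q v = (if v \<in> {a, p a} then v else p v)" for v
    proof (cases "v \<in> {a, p a}")
      case True
      then show ?thesis using inv[of a] by (auto simp: q_def)
    next
      case False
      \<comment> \<open>Applying \<open>p\<close> once more to either equality would put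
        \<open>v\<close> back into the orbit of \<open>a\<close>.\<close>
      then have "p v \<noteq> a" "p v \<noteq> p a" using inv by (metis insertCI)+
      then show ?thesis using False by (simp add: q_def)
    qed
    have moved: "{v. q v \<noteq> v} = {v. p v \<noteq> v} - {a, p a}"
      by (auto simp: q)
    have q_inv: "q (q v) = v" for v
    proof (cases "v \<in> {a, p a}")
      case False
      then have "p v \<notin> {a, p a}" using inv by (metis insertE insertCI singletonD)
      then show ?thesis using False inv by (simp add: q)
    qed (simp add: q)
    have fin_q: "finite {v. q v \<noteq> v}" using fin by (simp add: moved)
    have "card {v. q v \<noteq> v} < card {v. p v \<noteq> v}"
      by (rule psubset_card_mono[OF fin]) (use a in \<open>auto simp: moved\<close>)
    from less.hyps[OF this fin_q q_inv]
    have IH: "sign q = (-1) ^ card (moved_pairs q)" .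
    have pairs: "moved_pairs p = insert {a, p a} (moved_pairs q)"
    proof (intro equalityI subsetI)
      fix e assume "e \<in> moved_pairs p"
      then obtain v where v: "p v \<noteq> v" "e = {v, p v}" by (auto simp: moved_pairs_def)
      show "e \<in> insert {a, p a} (moved_pairs q)"
      proof (cases "v \<in> {a, p a}")
        case True
        then show ?thesis using v inv[of a] by auto
      next
        case False
        then have "q v \<noteq> v" "e = {v, q v}" using v by (auto simp: q)
        then show ?thesis by (auto simp: moved_pairs_def)
      qed
    next
      fix e assume "e \<in> insert {a, p a} (moved_pairs q)"
      then show "e \<in> moved_pairs p"
        using a by (auto simp: moved_pairs_def q split: if_splits)
    qed
    have notin: "{a, p a} \<notin> moved_pairs q"
      by (auto simp: moved_pairs_def q doubleton_eq_iff split: if_splits)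
    have "finite (moved_pairs q)" using fin_q by (simp add: moved_pairs_def)
    then have card: "card (moved_pairs p) = Suc (card (moved_pairs q))"
      using notin by (simp add: pairs)
    have p_perm: "p permutes {v. p v \<noteq> v}"
      by (rule involution_permutes) (use inv in auto)
    have "sign q = sign (transpose a (p a)) * sign p"
      unfolding q_def
      by (rule sign_compose) (use permutes_imp_permutation[OF fin p_perm] in
        \<open>auto simp: permutation_swap_id\<close>)
    then have "sign p = - sign q" using a by (simp add: sign_swap_id)
    then show ?thesis using IH card by simp
  qed
qed

section \<open>Orbits in a forest\<close>

text \<open>Otherwise the orbit of \<open>v\<close> has at least three points, and listing it as
  \<open>v\<close>, \<open>p v\<close>, \<open>p (p v)\<close> and so on yields a cycle of the
  graph.\<close>

lemma forest_permutation_involution: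
  assumes "forest V E" and "p permutes V" and edge: "\<And>v. p v \<noteq> v \<Longrightarrow> {v, p v} \<in> E"
  shows "p (p v) = v"
proof (rule ccontr)
  assume ppv: "p (p v) \<noteq> v"
  have pv: "p v \<noteq> v" using ppv by auto
  have perm: "permutation p"
    using assms(1,2) by (auto simp: forest_def simple_graph_def intro: permutes_imp_permutation)
  \<comment> \<open>\<open>k\<close> is the length of the orbit: \<open>support p v\<close> lists
    \<open>(p ^^ i) v\<close> for \<open>i < k\<close>, and the index wraps around because
    \<open>(p ^^ k) v = v\<close>.\<close>
  define k where "k = least_power p v"
  have k: "(p ^^ k) v = v" "k > 0"
    using least_power_of_permutation[OF perm] by (simp_all add: k_def)
  have "k \<noteq> 1" "k \<noteq> 2" using k pv ppv by (auto simp: numeral_2_eq_2)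
  with k have k3: "3 \<le> k" by simp
  have distinct: "distinct (support p v)"
    using cycle_of_permutation[OF perm] by simp
  have "is_cycle E (support p v)"
    unfolding is_cycle_def
  proof (intro conjI allI impI distinct)
    show "3 \<le> length (support p v)" using k3 by (simp add: k_def)
    fix i assume "i < length (support p v)"
    then have i: "i < k" by (simp add: k_def)
    have next_eq: "support p v ! (Suc i mod length (support p v)) = p ((p ^^ i) v)"
    proof (cases "Suc i = k")
      case True
      then have "p ((p ^^ i) v) = v" using k(1) by (metis comp_apply funpow.simps(2))
      then show ?thesis using True k by (simp add: k_def)
    next
      case False
      then show ?thesis using i by (simp add: k_def)
    qed
    \<comment> \<open>The edge hypothesis speaks of moved points only. Every point of the orbit is
      moved, since \<open>p ^^ i\<close> is injective and separates \<open>v\<close> from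
      \<open>p v\<close>.\<close>
    have "p ((p ^^ i) v) = (p ^^ i) (p v)" by (simp add: funpow_swap1)
    moreover have "inj (p ^^ i)" using perm by (simp add: permutation inj_fn bij_is_inj)
    ultimately have "p ((p ^^ i) v) \<noteq> (p ^^ i) v" using pv by (metis injD)
    from edge[OF this]
    show "{support p v ! i, support p v ! (Suc i mod length (support p v))} \<in> E"
      unfolding next_eq using i by (simp add: k_def)
  qed
  then show False using assms(1) by (auto simp: forest_def)
qed

section \<open>Involutions and matchings\<close>

text \<open>In a forest, every permutation with a nonzero Leibniz term belongs to this set.\<close>

definition edge_involutions :: "'v set \<Rightarrow> 'v set set \<Rightarrow> ('v \<Rightarrow> 'v) set" where
  "edge_involutions V E =
    {p. p permutes V \<and> (\<forall>v. p (p v) = v) \<and> (\<forall>v. p v \<noteq> v \<longrightarrow> {v, p v} \<in> E)}"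

lemma Union_moved_pairs:
  assumes "\<And>v. p (p v) = v"
  shows "\<Union>(moved_pairs p) = {v. p v \<noteq> v}"
proof (intro equalityI subsetI)
  fix w assume "w \<in> \<Union>(moved_pairs p)"
  then obtain v where "p v \<noteq> v" "w \<in> {v, p v}" by (auto simp: moved_pairs_def)
  then show "w \<in> {v. p v \<noteq> v}" using assms[of v] by auto
qed (auto simp: moved_pairs_def)

text \<open>The union of the pairs recovers the moved points, and the pair containing a moved point
  recovers its image.\<close>

lemma inj_on_moved_pairs: "inj_on moved_pairs (edge_involutions V E)"
proof (rule inj_onI, rule ext)
  fix p q v
  assume p: "p \<in> edge_involutions V E" and q: "q \<in> edge_involutions V E"
    and eq: "moved_pairs p = moved_pairs q"
  have inv: "p (p w) = w" "q (q w) = w" for w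
    using p q by (auto simp: edge_involutions_def)
  have "{v. p v \<noteq> v} = {v. q v \<noteq> v}"
    using Union_moved_pairs[of p] Union_moved_pairs[of q] inv eq by simp
  then have fixed: "p v = v \<longleftrightarrow> q v = v" by blast
  show "p v = q v"
  proof (cases "p v = v")
    case False
    then have "{v, p v} \<in> moved_pairs p" by (auto simp: moved_pairs_def)
    then have "{v, p v} \<in> moved_pairs q" by (simp only: eq)
    then obtain u where "{v, p v} = {u, q u}" by (auto simp: moved_pairs_def)
    then show ?thesis using inv(2)[of u] by (auto simp: doubleton_eq_iff)
  qed (use fixed in simp)
qed

lemma moved_pairs_image:
  assumes graph: "simple_graph V E"
  shows "moved_pairs ` edge_involutions V E = matchings E"
proof (intro equalityI subsetI)
  fix M assume "M \<in> moved_pairs ` edge_involutions V E"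
  then obtain p where p: "p \<in> edge_involutions V E" and M: "M = moved_pairs p" by blast
  have inv: "p (p v) = v" for v using p by (auto simp: edge_involutions_def)
  have "M \<subseteq> E" using p by (auto simp: M moved_pairs_def edge_involutions_def)
  moreover have "e \<inter> f = {}" if ef: "e \<in> M" "f \<in> M" "e \<noteq> f" for e f
  proof -
    \<comment> \<open>A pair is determined by either of its points, so pairs that meet
      coincide.\<close>
    have "e = {w, p w}" if "e \<in> M" "w \<in> e" for e w
      using that inv by (auto simp: M moved_pairs_def)
    then show ?thesis using ef by blast
  qed
  ultimately show "M \<in> matchings E" by (auto simp: matchings_def)
next
  fix M assume "M \<in> matchings E"
  then have ME: "M \<subseteq> E" and disj: "\<And>e f. e \<in> M \<Longrightarrow> f \<in> M \<Longrightarrow> e \<noteq> f \<Longrightarrow> e \<inter> f = {}"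
    by (auto simp: matchings_def)
  have edge: "e \<subseteq> V" "card e = 2" if "e \<in> M" for e
    using that ME graph by (auto simp: simple_graph_def)
  have neq: "v \<noteq> w" if "{v, w} \<in> M" for v w
    using edge(2)[OF that] by auto
  have uniq: "w = w'" if "{v, w} \<in> M" "{v, w'} \<in> M" for v w w'
    using disj[OF that] neq[OF that(1)] neq[OF that(2)] by (auto simp: doubleton_eq_iff)
  \<comment> \<open>The inverse construction: swap the two ends of each edge of \<open>M\<close> and
    fix all unmatched vertices. By \<open>uniq\<close> the choice operator has only one
    candidate.\<close>
  define p where "p v = (if \<exists>w. {v, w} \<in> M then SOME w. {v, w} \<in> M else v)" for v
  have p_eq: "p v = w" if "{v, w} \<in> M" for v w
  proof -
    have "{v, SOME w. {v, w} \<in> M} \<in> M" using that by (rule someI)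
    from uniq[OF this that] show ?thesis using that by (metis p_def)
  qed
  have p_moved: "{v, p v} \<in> M" if "p v \<noteq> v" for v
    using that p_eq by (metis p_def)
  have inv: "p (p v) = v" for v
  proof (cases "p v = v")
    case False
    from p_moved[OF this] show ?thesis by (intro p_eq) (simp add: insert_commute)
  qed simp
  have "p permutes V"
  proof (rule involution_permutes)
    show "p (p v) = v" for v by (rule inv)
    show "p v = v" if "v \<notin> V" for v using that p_moved edge(1) by blast
  qed
  then have "p \<in> edge_involutions V E"
    using inv p_moved ME by (auto simp: edge_involutions_def)
  moreover have "moved_pairs p = M"
  proof (intro equalityI subsetI)
    fix e assume "e \<in> moved_pairs p"
    then show "e \<in> M" using p_moved by (auto simp: moved_pairs_def)
  next
    fix e assume e: "e \<in> M"
    then obtain v w where vw: "e = {v, w}" "v \<noteq> w"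
      using edge(2) by (meson card_2_iff)
    then have "p v = w" using e p_eq by simp
    then show "e \<in> moved_pairs p" using vw by (auto simp: moved_pairs_def)
  qed
  ultimately show "M \<in> moved_pairs ` edge_involutions V E" by blast
qed

lemma card_Union_matching:
  assumes "simple_graph V E" and "M \<in> matchings E"
  shows "card (\<Union>M) = 2 * card M"
proof -
  have card: "card e = 2" if "e \<in> M" for e
    using that assms by (auto simp: matchings_def simple_graph_def)
  have "card (\<Union>M) = sum card M"
  proof (rule card_Union_disjoint)
    show "disjoint M" using assms(2) by (auto simp: matchings_def disjoint_def)
    show "finite e" if "e \<in> M" for e using card[OF that] by (simp add: card_ge_0_finite)
  qed
  then show ?thesis using card by simp
qed

section \<open>The determinant of a forest\<close>

text \<open>The common off-diagonal value \<open>c\<close> is left open so that \<open>-1\<close>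
  (adjacency matrix) and \<open>1\<close> (Laplacian) are treated together; arbitrary weights
  \<open>y\<close> cover all three polynomials.\<close>

lemma multivariate_matching_poly_forest:
  fixes y :: "'v \<Rightarrow> 'a::comm_ring_1"
  assumes forest: "forest V E" and vs: "distinct vs" "set vs = V" and c: "c * c = 1"
  shows "multivariate_matching_poly V E y = det (Matrix.mat (length vs) (length vs)
    (\<lambda>(i, j). if i = j then y (vs ! i) else if {vs ! i, vs ! j} \<in> E then c else 0))"
proof -
  have graph: "simple_graph V E" and fin: "finite V"
    using forest by (auto simp: forest_def simple_graph_def)
  define B where "B v w = (if v = w then y v else if {v, w} \<in> E then c else 0)" for v w
  have entries: "Matrix.mat (length vs) (length vs)
      (\<lambda>(i, j). if i = j then y (vs ! i) else if {vs ! i, vs ! j} \<in> E then c else 0) =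
      Matrix.mat (length vs) (length vs) (\<lambda>(i, j). B (vs ! i) (vs ! j))"
    by (rule eq_matI) (use vs(1) in \<open>auto simp: B_def nth_eq_iff_index_eq\<close>)
  have inv_sub: "edge_involutions V E \<subseteq> {p. p permutes V}"
    by (auto simp: edge_involutions_def)
  have zero: "(\<Prod>v\<in>V. B v (p v)) = 0" if p: "p permutes V" "p \<notin> edge_involutions V E" for p
  proof -
    \<comment> \<open>If every moved vertex went to a neighbour, the forest property would make
      \<open>p\<close> an edge involution.\<close>
    obtain v where v: "p v \<noteq> v" "{v, p v} \<notin> E"
      using p forest_permutation_involution[OF forest p(1)]
      by (auto simp: edge_involutions_def)
    have "v \<in> V" using v(1) p(1) by (meson permutes_not_in)
    moreover have "B v (p v) = 0" using v by (auto simp: B_def)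
    ultimately show ?thesis using fin by (intro prod_zero) auto
  qed
  have summand: "of_int (sign p) * (\<Prod>v\<in>V. B v (p v)) =
      (-1) ^ card (moved_pairs p) * (\<Prod>v\<in>V - \<Union>(moved_pairs p). y v)"
    if p: "p \<in> edge_involutions V E" for p
  proof -
    let ?U = "{v. p v \<noteq> v}"
    have pV: "p permutes V" and inv: "\<And>v. p (p v) = v"
      and edge: "\<And>v. p v \<noteq> v \<Longrightarrow> {v, p v} \<in> E"
      using p by (auto simp: edge_involutions_def)
    have U: "\<Union>(moved_pairs p) = ?U" by (rule Union_moved_pairs) (rule inv)
    have UV: "?U \<subseteq> V" using pV by (auto dest: permutes_not_in)
    then have finU: "finite ?U" using fin by (rule finite_subset)
    have "moved_pairs p \<in> matchings E" using moved_pairs_image[OF graph] p by blast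
    from card_Union_matching[OF graph this]
    have cardU: "card ?U = 2 * card (moved_pairs p)" by (simp add: U)
    have "(\<Prod>v\<in>V. B v (p v)) = (\<Prod>v\<in>V - ?U. B v (p v)) * (\<Prod>v\<in>?U. B v (p v))"
      by (rule prod.subset_diff[OF UV fin])
    also have "(\<Prod>v\<in>V - ?U. B v (p v)) = (\<Prod>v\<in>V - ?U. y v)"
      by (rule prod.cong) (auto simp: B_def)
    also have "(\<Prod>v\<in>?U. B v (p v)) = (\<Prod>v\<in>?U. c)"
      by (rule prod.cong) (use edge in \<open>auto simp: B_def\<close>)
    \<comment> \<open>The moved points come in pairs, so \<open>c\<close> occurs to an even
      power.\<close>
    also have "\<dots> = 1" using c by (simp add: cardU power_mult power2_eq_square)
    finally have "(\<Prod>v\<in>V. B v (p v)) = (\<Prod>v\<in>V - ?U. y v)" by simp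
    moreover have "sign p = (-1) ^ card (moved_pairs p)"
      by (rule sign_involution[OF finU]) (rule inv)
    ultimately show ?thesis by (simp add: U)
  qed
  have "det (Matrix.mat (length vs) (length vs) (\<lambda>(i, j). B (vs ! i) (vs ! j))) =
      (\<Sum>p | p permutes V. of_int (sign p) * (\<Prod>v\<in>V. B v (p v)))"
    using det_mat_nth[OF vs(1), of B] by (simp add: vs(2))
  also have "\<dots> = (\<Sum>p\<in>edge_involutions V E. of_int (sign p) * (\<Prod>v\<in>V. B v (p v)))"
    by (rule sum.mono_neutral_right) (use fin inv_sub zero in \<open>auto simp: finite_permutations\<close>)
  also have "\<dots> = (\<Sum>p\<in>edge_involutions V E.
      (-1) ^ card (moved_pairs p) * (\<Prod>v\<in>V - \<Union>(moved_pairs p). y v))"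
    by (rule sum.cong[OF refl summand])
  also have "\<dots> = (\<Sum>M\<in>moved_pairs ` edge_involutions V E.
      (-1) ^ card M * (\<Prod>v\<in>V - \<Union>M. y v))"
    by (simp add: sum.reindex[OF inj_on_moved_pairs])
  also have "\<dots> = multivariate_matching_poly V E y"
    by (simp add: moved_pairs_image[OF graph] multivariate_matching_poly_def)
  finally show ?thesis by (simp add: entries)
qed

section \<open>Specialisation of the weights\<close>

theorem theorem2p7:
  fixes V :: "'v set" and E :: "'v set set" and vs :: "'v list"
  assumes "forest V E"
    and "distinct vs" and "set vs = V"
  shows "multivariate_matching_poly V E (indet :: 'v \<Rightarrow> ('v \<Rightarrow>\<^sub>0 nat) \<Rightarrow>\<^sub>0 'r::comm_ring_1) =
           det (vertex_diag_mat vs indet - adjacency_mat E vs) \<and>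
         (matching_poly V E :: 'r poly) = char_poly (adjacency_mat E vs) \<and>
         (laplacian_matching_poly V E :: 'r poly) = char_poly (laplacian_mat E vs)"
proof (intro conjI)
  let ?n = "length vs"
  \<comment> \<open>The diagonal entries of the adjacency matrix test \<open>{v, v}\<close>, which
    is \<open>{v}\<close>; their vanishing leaves the diagonal to the weights.\<close>
  have no_loop: "{v} \<notin> E" for v
    using assms(1) by (auto simp: forest_def simple_graph_def)
  note expand = multivariate_matching_poly_forest[OF assms]
  show "multivariate_matching_poly V E (indet :: 'v \<Rightarrow> ('v \<Rightarrow>\<^sub>0 nat) \<Rightarrow>\<^sub>0 'r) =
      det (vertex_diag_mat vs indet - adjacency_mat E vs)"
    by (subst expand[of "-1"])
      (auto intro!: arg_cong[where f = det] eq_matI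
        simp: vertex_diag_mat_def mat_diag_def adjacency_mat_def no_loop)
  have "(matching_poly V E :: 'r poly) = multivariate_matching_poly V E (\<lambda>_. [:0, 1:])"
    by (simp add: matching_poly_def multivariate_matching_poly_def)
  also have "\<dots> = char_poly (adjacency_mat E vs)"
    by (subst expand[of "-1"])
      (auto intro!: arg_cong[where f = det] eq_matI
        simp: char_poly_def char_poly_matrix_def adjacency_mat_def no_loop one_pCons)
  finally show "(matching_poly V E :: 'r poly) = char_poly (adjacency_mat E vs)" .
  have "(laplacian_matching_poly V E :: 'r poly) =
      multivariate_matching_poly V E (\<lambda>v. [:0, 1:] - of_nat (vertex_degree E v))"
    by (simp add: laplacian_matching_poly_def multivariate_matching_poly_def)
  also have "\<dots> = char_poly (laplacian_mat E vs)"
    \<comment> \<open>Here \<open>c\<close> is \<open>1\<close>, since subtracting the Laplacian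
      from the scalar matrix adds the adjacency matrix.\<close>
    by (subst expand[of 1])
      (auto intro!: arg_cong[where f = det] eq_matI
        simp: char_poly_def char_poly_matrix_def laplacian_mat_def degree_mat_def
          vertex_diag_mat_def mat_diag_def adjacency_mat_def no_loop one_pCons of_nat_poly)
  finally show "(laplacian_matching_poly V E :: 'r poly) = char_poly (laplacian_mat E vs)" .
qed

end
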